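(* Let $f$ be a polynomial of degree $m\ge 2$ such that $\Omega=\Omega(f)$ is simply connected. Let $R:\mathbb{D}\to\Omega$ be a biholomorphic map with $R(0)=\infty$, normalized (by precomposing with a rotation) so that $R^{-1}\circ f\circ R(z)=z^{m}$ on $\mathbb{D}$, and let $F=R^{-1}:\Omega\to\mathbb{D}$. Fix $r_0\in(0,1)$ and $z_0\in\mathbb{C}$ with $|z_0|=r_0$; put $w_0=R(z_0)$. For $n\ge 1$ let $z_{n,k}$ $(0\le k<m^{n})$ be the $m^n$ solutions of $z^{m^n}=z_0$ in $\mathbb{D}$, and $w_{n,k}=R(z_{n,k})$ (these are the $m^n$ preimages of $w_0$ under $f^n$), and set $$S_{n}=\sum_{k=0}^{m^{n}-1}\left|(f^{n})'(w_{n,k})\right|^{2}.$$ Then there are constants $C_1,C_2<+\infty$, independent of $p$, such that for every $2\le p\le 4$, $$\int_{\Omega\cap\mathbb{C}}|F'(z)|^{p}\,dA(z)\;<\;C_{1}\sum_{n=1}^{+\infty}m^{-4n}S_{n}+C_{2}.$$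
   Context: $\Omega(f)=\{z\in\hat{\mathbb{C}}: f^{n}(z)\to\infty\}$ is the basin of attraction of infinity ($f^n$ the $n$-th iterate), $dA$ is Lebesgue area measure. The right-hand side may be $+\infty$.
   Formalization: The bound is stated only when the series of m^{-4n} S_n converges; when it diverges the right-hand side is +∞ and the strict inequality can fail (f = z²−2, p = 4: both sides are infinite), so nothing is claimed then. *)

theory Defs
  imports "HOL-Complex_Analysis.Complex_Analysis" "HOL-Computational_Algebra.Polynomial"
begin

text \<open>The finite part \<open>\<Omega>(f) \<inter> \<complex>\<close> of the basin of attraction of infinity of a polynomial f.\<close>
definition basin_inf :: "complex poly \<Rightarrow> complex set" where
  "basin_inf f = {z. filterlim (\<lambda>n. (poly f ^^ n) z) at_infinity sequentially}"

definition S_sum :: "complex poly \<Rightarrow> (complex \<Rightarrow> complex) \<Rightarrow> complex \<Rightarrow> nat \<Rightarrow> real" where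
  "S_sum f R z0 n =
     (\<Sum>z\<in>{z. z \<in> ball 0 1 \<and> z ^ (degree f ^ n) = z0}.
        (cmod (deriv (poly f ^^ n) (R z)))\<^sup>2)"

end

theory Submission
  imports Defs
begin

text \<open>Write \<open>M = m ^ n\<close>. The relation \<open>(f ^ n) (R z) = R (z ^ M)\<close> gives
  \<open>1 / |R' \<zeta>| \<le> const * |(f ^ n)' (R \<zeta>)| / M\<close> at the roots \<open>\<zeta> ^ M = z0\<close>. Every point of the
  annulus \<open>r0 \<le> |z| ^ M\<close>, \<open>|z| ^ (m M) < r0\<close> is within distance \<open>const / M\<close> of such a root, hence
  within bounded hyperbolic distance, so by distortion \<open>|R' z|\<close> is comparable to \<open>|R' \<zeta>|\<close>, and the
  image under \<open>R\<close> of the part of the annulus near \<open>\<zeta>\<close> lies in a disc of radius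
  \<open>const * |R' \<zeta>| / M\<close>. Bounding \<open>|F'| ^ 4\<close> by a constant on each of these discs
  majorizes the integral without any change of variables: one annulus contributes at most
  \<open>const * (\<Sum>\<zeta>. 1 / (M |R' \<zeta>|)\<^sup>2) \<le> const * S_n / M ^ 4\<close>. Away from the boundary of the basin,
  \<open>|F'|\<close> is bounded and is \<open>O(1 / |w|\<^sup>2)\<close> at infinity. The exponents \<open>2 \<le> p \<le> 4\<close> are handled
  uniformly by \<open>x powr p \<le> x\<^sup>2 + x ^ 4\<close>, where \<open>x\<^sup>2 \<le> 1 + x ^ 4\<close> on the bounded part.\<close>

section \<open>Distortion of univalent functions\<close>

lemma univalent_omits_value:
  assumes hol: "h holomorphic_on ball a r" and inj: "inj_on h (ball a r)"
    and "0 < r" and \<rho>: "r * norm (deriv h a) < \<rho>"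
  obtains w where "w \<notin> h ` ball a r" "norm (w - h a) < \<rho>"
proof (rule ccontr)
  assume "\<not> thesis"
  then have covered: "ball (h a) \<rho> \<subseteq> h ` ball a r"
    by (metis dist_norm mem_ball norm_minus_commute subsetI that)
  obtain k where k_hol: "k holomorphic_on h ` ball a r"
    and k_deriv: "\<And>z. z \<in> ball a r \<Longrightarrow> deriv h z * deriv k (h z) = 1"
    and k_h: "\<And>z. z \<in> ball a r \<Longrightarrow> k (h z) = z"
    using holomorphic_has_inverse[OF hol open_ball inj] by metis
  obtain s where s: "r * norm (deriv h a) < s" "s < \<rho>"
    using dense[OF \<rho>] by blast
  have "0 < s"
    using s(1) \<open>0 < r\<close> by (smt (verit) mult_nonneg_nonneg norm_ge_zero)
  have covered_s: "cball (h a) s \<subseteq> h ` ball a r"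
    using covered s(2) by (force simp: subset_iff)
  have "norm ((deriv ^^ 1) k (h a)) \<le> fact 1 * r / s ^ 1"
  proof (rule Cauchy_higher_deriv_bound)
    show "k holomorphic_on ball (h a) s" "continuous_on (cball (h a) s) k"
      using covered_s ball_subset_cball
      by (blast intro: holomorphic_on_subset[OF k_hol] holomorphic_on_imp_continuous_on)+
    show "k w \<in> ball a r" if w: "w \<in> ball (h a) s" for w
    proof -
      obtain x where "x \<in> ball a r" "w = h x"
        using w covered_s by force
      then show ?thesis
        using k_h by simp
    qed
  qed (use \<open>0 < s\<close> in auto)
  then have "norm (deriv h a) * norm (deriv k (h a)) \<le> norm (deriv h a) * (r / s)"
    by (intro mult_left_mono) auto
  moreover have "norm (deriv h a) * norm (deriv k (h a)) = 1"
    using k_deriv[of a] \<open>0 < r\<close> by (simp flip: norm_mult)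
  ultimately show False
    using s(1) \<open>0 < s\<close> by (simp add: field_simps)
qed

text \<open>Schottky's bound at \<open>|z| \<le> 1 / 2\<close> for a function on the unit disc with
  \<open>|f 0| \<le> 1 / 2\<close> that omits \<open>0\<close> and \<open>1\<close>.\<close>
definition schottky_const :: real where
  "schottky_const = exp (pi * exp (15 * pi))"

lemma Schottky_ball:
  assumes hol: "g holomorphic_on ball a r" and "0 < r" and ga: "norm (g a) \<le> 1 / 2"
    and omits: "0 \<notin> g ` ball a r" "1 \<notin> g ` ball a r"
    and z: "norm (z - a) \<le> r / 4"
  shows "norm (g z) \<le> schottky_const"
proof -
  define scale :: "complex \<Rightarrow> complex" where "scale \<zeta> = a + of_real (r / 2) * \<zeta>" for \<zeta>
  have scale_in: "scale \<zeta> \<in> ball a r" if "\<zeta> \<in> cball 0 1" for \<zeta>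
  proof -
    have "r / 2 * norm \<zeta> \<le> r / 2 * 1"
      using that \<open>0 < r\<close> by (intro mult_left_mono) auto
    then show ?thesis
      using \<open>0 < r\<close> by (simp add: scale_def dist_norm norm_mult)
  qed
  define \<zeta> where "\<zeta> = (z - a) / of_real (r / 2)"
  have scale_\<zeta>: "scale \<zeta> = z"
    using \<open>0 < r\<close> by (simp add: scale_def \<zeta>_def field_simps)
  have norm_\<zeta>: "norm \<zeta> \<le> 1 / 2"
    using \<open>0 < r\<close> z unfolding \<zeta>_def norm_divide norm_of_real by (simp add: field_simps)
  have "norm ((g \<circ> scale) \<zeta>)
      \<le> exp (pi * exp (pi * (2 + 2 * (1 / 2) + 12 * (1 / 2) / (1 - 1 / 2))))"
  proof (rule Schottky[where f = "g \<circ> scale" and z = \<zeta>])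
    show "g \<circ> scale holomorphic_on cball 0 1"
    proof (rule holomorphic_on_compose_gen[OF _ hol])
      show "scale holomorphic_on cball 0 1"
        unfolding scale_def by (intro holomorphic_intros)
    qed (use scale_in in blast)
    show "norm ((g \<circ> scale) 0) \<le> 1 / 2"
      using ga by (simp add: scale_def)
    show "\<not> ((g \<circ> scale) x = 0 \<or> (g \<circ> scale) x = 1)" if "x \<in> cball 0 1" for x
      using omits scale_in[OF that] by (metis comp_apply imageI)
  qed (use norm_\<zeta> in auto)
  then show ?thesis
    by (simp add: schottky_const_def scale_\<zeta> mult.commute)
qed

lemma norm_le_if_omits_opposite_values:
  assumes hol: "g holomorphic_on ball a r" and "0 < r" and "g a = 0"
    and omits: "c \<notin> g ` ball a r" "- c \<notin> g ` ball a r"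
    and z: "norm (z - a) \<le> r / 4"
  shows "norm (g z) \<le> (2 * schottky_const + 1) * norm c"
proof -
  have "c \<noteq> 0"
    using omits(1) \<open>0 < r\<close> \<open>g a = 0\<close> by (metis centre_in_ball imageI)
  define \<phi> where "\<phi> x = (g x / c + 1) / 2" for x
  have \<phi>_eq: "\<phi> x = 0 \<longleftrightarrow> g x = - c" "\<phi> x = 1 \<longleftrightarrow> g x = c" for x
    using \<open>c \<noteq> 0\<close> by (auto simp: \<phi>_def field_simps add_eq_0_iff2)
  have "norm (\<phi> z) \<le> schottky_const"
  proof (rule Schottky_ball[OF _ \<open>0 < r\<close> _ _ _ z])
    show "\<phi> holomorphic_on ball a r"
      unfolding \<phi>_def by (intro holomorphic_intros hol) (use \<open>c \<noteq> 0\<close> in auto)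
    show "0 \<notin> \<phi> ` ball a r" "1 \<notin> \<phi> ` ball a r"
      using omits \<phi>_eq by (metis imageE imageI)+
  qed (simp add: \<phi>_def \<open>g a = 0\<close>)
  moreover have "norm (2 * \<phi> z - 1) \<le> 2 * norm (\<phi> z) + 1"
    by (metis norm_triangle_ineq4 norm_mult norm_numeral norm_one)
  ultimately have "norm (2 * \<phi> z - 1) \<le> 2 * schottky_const + 1"
    by simp
  moreover have "g z = (2 * \<phi> z - 1) * c"
    using \<open>c \<noteq> 0\<close> by (simp add: \<phi>_def field_simps)
  ultimately show ?thesis
    by (simp add: norm_mult mult_right_mono)
qed

lemma holomorphic_log_vanishing_at_center:
  assumes hol: "q holomorphic_on ball a r" and "0 < r" and "q a = 1"
    and nonzero: "\<And>x. x \<in> ball a r \<Longrightarrow> q x \<noteq> 0"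
  obtains g where "g holomorphic_on ball a r" "g a = 0" "\<And>x. x \<in> ball a r \<Longrightarrow> q x = exp (g x)"
proof -
  obtain g where g: "g holomorphic_on ball a r" "\<And>x. x \<in> ball a r \<Longrightarrow> q x = exp (g x)"
    using contractible_imp_holomorphic_log[OF hol convex_imp_contractible[OF convex_ball] nonzero]
    by blast
  have "exp (g a) = 1"
    using g(2)[of a] \<open>0 < r\<close> \<open>q a = 1\<close> by simp
  then have "q x = exp (g x - g a)" if "x \<in> ball a r" for x
    using g(2)[OF that] by (simp add: exp_diff)
  moreover have "(\<lambda>x. g x - g a) holomorphic_on ball a r"
    by (intro holomorphic_intros g(1))
  ultimately show thesis
    using that[of "\<lambda>x. g x - g a"] by simp
qed

text \<open>As \<open>h\<close> takes the value \<open>h a\<close> only at \<open>a\<close>, where \<open>g\<close> vanishes, \<open>g\<close> omits every nonzero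
  period of \<open>exp\<close>; this makes Schottky's theorem applicable.\<close>
lemma univalent_eq_exp_at_omitted_value:
  assumes hol: "h holomorphic_on ball a r" and inj: "inj_on h (ball a r)" and "0 < r"
    and w: "w \<notin> h ` ball a r"
  obtains g where "g holomorphic_on ball a r" "g a = 0"
    "\<And>x. x \<in> ball a r \<Longrightarrow> h x - h a = (w - h a) * (1 - exp (g x))"
    "\<And>c. exp c = 1 \<Longrightarrow> c \<noteq> 0 \<Longrightarrow> c \<notin> g ` ball a r"
proof -
  have a: "a \<in> ball a r"
    using \<open>0 < r\<close> by simp
  have w_ne: "w \<noteq> h x" if "x \<in> ball a r" for x
    using w that by blast
  define q where "q x = (w - h x) / (w - h a)" for x
  have "q holomorphic_on ball a r" "q a = 1"
    unfolding q_def using w_ne[OF a] by (auto intro!: holomorphic_intros hol)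
  moreover have "q x \<noteq> 0" if "x \<in> ball a r" for x
    using w_ne[OF that] w_ne[OF a] by (simp add: q_def)
  ultimately obtain g where g: "g holomorphic_on ball a r" "g a = 0"
    and exp_g: "\<And>x. x \<in> ball a r \<Longrightarrow> q x = exp (g x)"
    using holomorphic_log_vanishing_at_center[OF _ \<open>0 < r\<close>] by blast
  have h_eq: "h x - h a = (w - h a) * (1 - exp (g x))" if "x \<in> ball a r" for x
    using exp_g[OF that] w_ne[OF a] by (simp add: q_def field_simps)
  have g_omits: "c \<notin> g ` ball a r" if "exp c = 1" "c \<noteq> 0" for c
  proof
    assume "c \<in> g ` ball a r"
    then obtain x where x: "x \<in> ball a r" "c = g x" by blast
    then have "h x = h a"
      using h_eq[OF x(1)] \<open>exp c = 1\<close> by simp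
    then have "x = a"
      using inj_onD[OF inj _ x(1) a] by blast
    then show False
      using x(2) \<open>c \<noteq> 0\<close> g(2) by simp
  qed
  show thesis
    using that[OF g h_eq g_omits] .
qed

definition univalent_growth_const :: real where
  "univalent_growth_const = 2 * (1 + exp (2 * pi * (2 * schottky_const + 1)))"

lemma univalent_growth:
  assumes hol: "h holomorphic_on ball a r" and inj: "inj_on h (ball a r)"
    and "0 < r" and z: "norm (z - a) \<le> r / 4"
  shows "norm (h z - h a) < univalent_growth_const * (r * norm (deriv h a))"
proof -
  define L where "L = 2 * pi * (2 * schottky_const + 1)"
  have z_in: "z \<in> ball a r"
    using z \<open>0 < r\<close> by (auto simp: dist_norm norm_minus_commute)
  have "deriv h a \<noteq> 0"
    using holomorphic_injective_imp_regular[OF hol open_ball inj] \<open>0 < r\<close> by simp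
  then obtain w where w: "w \<notin> h ` ball a r"
    and w_near: "norm (w - h a) < 2 * (r * norm (deriv h a))"
    using univalent_omits_value[OF hol inj \<open>0 < r\<close>, of "2 * (r * norm (deriv h a))"] \<open>0 < r\<close>
    by auto
  obtain g where g: "g holomorphic_on ball a r" "g a = 0"
    and h_eq: "\<And>x. x \<in> ball a r \<Longrightarrow> h x - h a = (w - h a) * (1 - exp (g x))"
    and g_omits: "\<And>c. exp c = 1 \<Longrightarrow> c \<noteq> 0 \<Longrightarrow> c \<notin> g ` ball a r"
    using univalent_eq_exp_at_omitted_value[OF hol inj \<open>0 < r\<close> w] by blast
  have "norm (g z) \<le> (2 * schottky_const + 1) * norm (2 * pi * \<i>)"
    using g_omits
    by (intro norm_le_if_omits_opposite_values[OF g(1) \<open>0 < r\<close> g(2) _ _ z])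
      (auto simp: exp_minus)
  then have "norm (exp (g z)) \<le> exp L"
    by (intro order_trans[OF norm_exp]) (simp add: L_def norm_mult mult_ac)
  then have "norm (1 - exp (g z)) \<le> 1 + exp L"
    by (smt (verit) norm_triangle_ineq4 norm_one)
  then have "norm (h z - h a) \<le> norm (w - h a) * (1 + exp L)"
    by (simp add: h_eq[OF z_in] norm_mult mult_left_mono)
  also have "\<dots> < 2 * (r * norm (deriv h a)) * (1 + exp L)"
    using w_near by (intro mult_strict_right_mono) (auto intro: add_pos_pos)
  finally show ?thesis
    by (simp add: univalent_growth_const_def L_def algebra_simps)
qed

definition koebe_const :: real where
  "koebe_const = 32 * univalent_growth_const"

lemma koebe_const_pos: "0 < koebe_const"
  by (simp add: koebe_const_def univalent_growth_const_def add_pos_pos)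

lemma univalent_second_deriv_le:
  assumes hol: "h holomorphic_on ball a r" and inj: "inj_on h (ball a r)" and "0 < r"
  shows "norm (deriv (deriv h) a) \<le> koebe_const / r * norm (deriv h a)"
proof -
  have sub: "cball a (r / 4) \<subseteq> ball a r"
    using \<open>0 < r\<close> by auto
  have "norm ((deriv ^^ 2) h a)
      \<le> fact 2 * (univalent_growth_const * (r * norm (deriv h a))) / (r / 4) ^ 2"
  proof (rule Cauchy_higher_deriv_bound)
    show "h holomorphic_on ball a (r / 4)" "continuous_on (cball a (r / 4)) h"
      using sub ball_subset_cball
      by (blast intro: holomorphic_on_subset[OF hol] holomorphic_on_imp_continuous_on)+
    show "h z \<in> ball (h a) (univalent_growth_const * (r * norm (deriv h a)))"
      if "z \<in> ball a (r / 4)" for z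
      using univalent_growth[OF hol inj \<open>0 < r\<close>, of z] that
      by (simp add: dist_norm norm_minus_commute)
  qed (use \<open>0 < r\<close> in auto)
  also have "fact 2 * (univalent_growth_const * (r * norm (deriv h a))) / (r / 4) ^ 2
      = koebe_const / r * norm (deriv h a)"
    using \<open>0 < r\<close> by (simp add: koebe_const_def power2_eq_square field_simps)
  finally show ?thesis
    by (simp add: numeral_2_eq_2)
qed

lemma norm_le_exp_of_deriv_le:
  fixes u :: "complex \<Rightarrow> complex"
  assumes hol: "u holomorphic_on V" and V: "open V" "convex V"
    and nonzero: "\<And>s. s \<in> V \<Longrightarrow> u s \<noteq> 0"
    and seg: "closed_segment x y \<subseteq> V"
    and deriv_le: "\<And>s. s \<in> closed_segment x y \<Longrightarrow> norm (deriv u s) \<le> k * norm (u s)"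
  shows "norm (u x) \<le> exp (k * norm (x - y)) * norm (u y)"
proof -
  obtain g where g: "g holomorphic_on V" and exp_g: "\<And>s. s \<in> V \<Longrightarrow> u s = exp (g s)"
    using contractible_imp_holomorphic_log[OF hol convex_imp_contractible[OF V(2)] nonzero] by blast
  have g_deriv: "(g has_field_derivative deriv g s) (at s)" if "s \<in> V" for s
    using holomorphic_derivI[OF g V(1) that] .
  have "norm (g x - g y) \<le> k * norm (x - y)"
  proof (rule field_differentiable_bound[OF convex_closed_segment])
    fix s assume s: "s \<in> closed_segment x y"
    then have "s \<in> V" using seg by blast
    show "(g has_field_derivative deriv g s) (at s within closed_segment x y)"
      using g_deriv[OF \<open>s \<in> V\<close>] has_field_derivative_at_within by blast
    have "((\<lambda>z. exp (g z)) has_field_derivative exp (g s) * deriv g s) (at s)"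
      using g_deriv[OF \<open>s \<in> V\<close>] by (auto intro!: derivative_eq_intros)
    then have "(u has_field_derivative u s * deriv g s) (at s)"
      unfolding exp_g[OF \<open>s \<in> V\<close>]
      by (rule has_field_derivative_transform_within_open[OF _ V(1) \<open>s \<in> V\<close>])
        (simp add: exp_g)
    then have "norm (u s) * norm (deriv g s) \<le> norm (u s) * k"
      using deriv_le[OF s] DERIV_imp_deriv by (fastforce simp: norm_mult mult.commute)
    then show "norm (deriv g s) \<le> k"
      by (rule mult_left_le_imp_le) (use nonzero[OF \<open>s \<in> V\<close>] in simp)
  qed auto
  then have "norm (exp (g x - g y)) \<le> exp (k * norm (x - y))"
    by (meson norm_exp order_trans exp_le_cancel_iff)
  moreover have "u x = exp (g x - g y) * u y"
    using exp_g seg by (simp add: exp_diff subset_iff)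
  ultimately show ?thesis
    by (simp add: norm_mult mult_right_mono)
qed

lemma univalent_deriv_le:
  assumes hol: "h holomorphic_on U" and inj: "inj_on h U" and "0 < d"
    and nbhd: "\<And>s. s \<in> closed_segment x y \<Longrightarrow> ball s d \<subseteq> U"
  shows "norm (deriv h x) \<le> exp (koebe_const / d * norm (x - y)) * norm (deriv h y)"
proof -
  define V where "V = (\<Union>s\<in>closed_segment x y. \<Union>v\<in>ball 0 d. {s + v})"
  have V: "open V" "convex V"
    unfolding V_def by (auto intro!: open_sums convex_sums)
  have seg: "closed_segment x y \<subseteq> V"
    using \<open>0 < d\<close> by (force simp: V_def)
  have "V \<subseteq> U"
    using nbhd by (fastforce simp: V_def subset_iff dist_norm)
  then have hol_V: "h holomorphic_on V" and inj_V: "inj_on h V"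
    using hol inj holomorphic_on_subset inj_on_subset by blast+
  show ?thesis
  proof (rule norm_le_exp_of_deriv_le[OF holomorphic_deriv[OF hol_V V(1)] V _ seg])
    show "deriv h s \<noteq> 0" if "s \<in> V" for s
      using holomorphic_injective_imp_regular[OF hol_V V(1) inj_V that] .
    show "norm (deriv (deriv h) s) \<le> koebe_const / d * norm (deriv h s)"
      if "s \<in> closed_segment x y" for s
      using univalent_second_deriv_le[OF holomorphic_on_subset[OF hol] inj_on_subset[OF inj]
          \<open>0 < d\<close>] nbhd[OF that] by blast
  qed
qed

lemma univalent_norm_diff_le:
  assumes hol: "h holomorphic_on U" and inj: "inj_on h U" and "0 < d"
    and nbhd: "\<And>s. s \<in> closed_segment x y \<Longrightarrow> ball s d \<subseteq> U"
  shows "norm (h x - h y) \<le> exp (koebe_const / d * norm (x - y)) * norm (deriv h y) * norm (x - y)"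
proof (rule field_differentiable_bound[OF convex_closed_segment])
  fix s assume s: "s \<in> closed_segment x y"
  have "(h has_field_derivative deriv h s) (at s)"
    using nbhd[OF s] \<open>0 < d\<close> holomorphic_on_subset[OF hol]
    by (intro holomorphic_derivI[of h "ball s d"]) auto
  then show "(h has_field_derivative deriv h s) (at s within closed_segment x y)"
    by (rule has_field_derivative_at_within)
  have "closed_segment s y \<subseteq> closed_segment x y"
    using s by (simp add: subset_closed_segment)
  then have "norm (deriv h s) \<le> exp (koebe_const / d * norm (s - y)) * norm (deriv h y)"
    using nbhd by (intro univalent_deriv_le[OF hol inj \<open>0 < d\<close>]) blast
  also have "\<dots> \<le> exp (koebe_const / d * norm (x - y)) * norm (deriv h y)"
    using segment_bound(2)[OF s] koebe_const_pos \<open>0 < d\<close>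
    by (intro mult_right_mono)
      (auto intro!: divide_right_mono mult_left_mono simp: norm_minus_commute)
  finally show "norm (deriv h s) \<le> exp (koebe_const / d * norm (x - y)) * norm (deriv h y)" .
qed auto

lemma deriv_inv_into:
  assumes hol: "h holomorphic_on U" and U: "open U" and inj: "inj_on h U" and z: "z \<in> U"
  shows "deriv (inv_into U h) (h z) = inverse (deriv h z)"
proof (rule DERIV_imp_deriv, rule has_field_derivative_inverse_strong[where f=h and S=U])
  show "DERIV h z :> deriv h z" by (rule holomorphic_derivI[OF hol U z])
  show "deriv h z \<noteq> 0" by (rule holomorphic_injective_imp_regular[OF hol U inj z])
  show "continuous_on U h" by (rule holomorphic_on_imp_continuous_on[OF hol])
qed (use U z inj in auto)

lemma univalent_inverse_deriv_bounded:
  assumes hol: "h holomorphic_on U" and U: "open U" and inj: "inj_on h U"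
    and T: "compact T" "T \<subseteq> U"
  shows "bounded ((\<lambda>z. inverse (deriv h z)) ` T)"
proof (rule compact_imp_bounded, rule compact_continuous_image[OF continuous_on_inverse T(1)])
  show "continuous_on T (deriv h)"
    using holomorphic_deriv[OF hol U] T(2) continuous_on_subset holomorphic_on_imp_continuous_on
    by blast
  show "\<forall>z\<in>T. deriv h z \<noteq> 0"
    using holomorphic_injective_imp_regular[OF hol U inj] T(2) by blast
qed

section \<open>Roots close to a point near the unit circle\<close>

lemma norm_exp_diff_le:
  fixes u w :: complex
  assumes "Re u \<le> 0" "Re w \<le> 0"
  shows "norm (exp u - exp w) \<le> norm (u - w)"
proof -
  have "norm (exp u - exp w) \<le> 1 * norm (u - w)"
  proof (rule field_differentiable_bound[where S="{z. Re z \<le> 0}" and f' = exp])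
    show "(exp has_field_derivative exp s) (at s within {z. Re z \<le> 0})" for s :: complex
      by (auto intro!: derivative_eq_intros)
  qed (use assms in \<open>auto simp: convex_halfspace_Re_le\<close>)
  then show ?thesis by simp
qed

lemma exists_log_Im_near:
  fixes z :: complex
  assumes "z \<noteq> 0"
  obtains L where "exp L = z" "\<bar>Im L - y\<bar> \<le> pi"
proof
  define k where "k = round ((y - Im (Ln z)) / (2 * pi))"
  define L where "L = Ln z + of_int (2 * k) * pi * \<i>"
  show "exp L = z"
    using assms exp_Ln[OF assms] exp_eq[of L "Ln z"] unfolding L_def by auto
  have "\<bar>Im L - y\<bar> = 2 * pi * \<bar>of_int k - (y - Im (Ln z)) / (2 * pi)\<bar>"
    using pi_gt_zero by (simp add: L_def abs_mult[symmetric] field_simps)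
  also have "\<dots> \<le> 2 * pi * (1 / 2)"
    unfolding k_def by (intro mult_left_mono of_int_round_abs_le) auto
  finally show "\<bar>Im L - y\<bar> \<le> pi" by simp
qed

lemma exists_root_near:
  fixes z z0 :: complex
  assumes "z0 \<noteq> 0" "0 < M" and z: "norm z0 \<le> norm z ^ M" "norm z \<le> 1"
  obtains \<zeta> where "\<zeta> ^ M = z0" "norm (z - \<zeta>) \<le> (pi - ln (norm z0)) / M"
proof -
  have "z \<noteq> 0"
    using assms by (auto simp: power_0_left)
  obtain L where L: "exp L = z0" "\<bar>Im L - M * Im (Ln z)\<bar> \<le> pi"
    using exists_log_Im_near[OF \<open>z0 \<noteq> 0\<close>] by blast
  define v where "v = of_nat M * Ln z"
  have Re_L: "Re L = ln (norm z0)"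
    by (simp flip: L(1))
  have "ln (norm z0) \<le> ln (norm z ^ M)"
    using z(1) \<open>z0 \<noteq> 0\<close> \<open>z \<noteq> 0\<close> by simp
  then have "Re L \<le> Re v"
    using \<open>z \<noteq> 0\<close> by (simp add: Re_L v_def ln_realpow)
  moreover have "Re v \<le> 0"
    using z(2) \<open>z \<noteq> 0\<close> by (simp add: v_def mult_nonneg_nonpos)
  moreover have "\<bar>Im (L - v)\<bar> \<le> pi"
    using L(2) by (simp add: v_def)
  ultimately have "norm (L - v) \<le> pi - ln (norm z0)"
    using cmod_le[of "L - v"] Re_L by simp
  then have near: "norm (L / M - Ln z) \<le> (pi - ln (norm z0)) / M"
    using \<open>0 < M\<close> norm_divide[of "L - v" "of_nat M"]
    by (simp add: v_def diff_divide_distrib[of L] divide_right_mono)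
  have "norm (exp (L / M) - exp (Ln z)) \<le> norm (L / M - Ln z)"
    using \<open>Re L \<le> Re v\<close> \<open>Re v \<le> 0\<close> z(2) \<open>z \<noteq> 0\<close> \<open>0 < M\<close>
    by (intro norm_exp_diff_le) (auto simp: divide_nonpos_pos)
  then have "norm (z - exp (L / M)) \<le> (pi - ln (norm z0)) / M"
    using near \<open>z \<noteq> 0\<close> by (simp add: norm_minus_commute)
  moreover have "exp (L / M) ^ M = z0"
    using \<open>0 < M\<close> by (simp add: L(1) flip: exp_of_nat_mult)
  ultimately show thesis
    using that by blast
qed

lemma le_one_minus_of_power_le:
  fixes x r :: real
  assumes "0 \<le> x" "x ^ P \<le> r" "0 < P"
  shows "x \<le> 1 - (1 - r) / real P"
proof -
  have "1 + real P * (x - 1) \<le> (1 + (x - 1)) ^ P"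
    by (rule Bernoulli_inequality) (use assms in simp)
  then have "(1 - r) / real P \<le> 1 - x"
    using assms by (simp add: field_simps)
  then show ?thesis by simp
qed

lemma one_plus_ln_div_le_of_power_eq:
  fixes x r :: real
  assumes "0 \<le> x" "x ^ M = r" "0 < r" "0 < M"
  shows "1 + ln r / real M \<le> x"
proof -
  have "0 < x"
    using assms by (cases "x = 0") (auto simp: power_0_left)
  then have "ln r / M = ln x"
    using assms by (auto simp: ln_realpow)
  then show ?thesis
    using ln_le_minus_one[OF \<open>0 < x\<close>] by simp
qed

lemma ball_subset_punctured_disc:
  fixes z \<zeta> s :: complex
  assumes r: "0 < r" "r < 1" and "0 < P" and powers: "norm z ^ P \<le> r" "norm \<zeta> ^ P \<le> r"
    and \<zeta>: "3 / 4 \<le> norm \<zeta>" "norm (z - \<zeta>) \<le> 1 / 4" and s: "s \<in> closed_segment z \<zeta>"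
  shows "ball s ((1 - r) / (2 * real P)) \<subseteq> ball 0 1 - {0}"
proof
  define d where "d = (1 - r) / (2 * real P)"
  have d: "0 < d" "d < 1 / 2"
    using r \<open>0 < P\<close> by (auto simp: d_def field_simps intro: less_le_trans[of _ 1])
  have "2 * d = (1 - r) / P"
    using \<open>0 < P\<close> by (simp add: d_def field_simps)
  then have "norm z \<le> 1 - 2 * d" "norm \<zeta> \<le> 1 - 2 * d"
    using le_one_minus_of_power_le[OF norm_ge_zero powers(1) \<open>0 < P\<close>]
      le_one_minus_of_power_le[OF norm_ge_zero powers(2) \<open>0 < P\<close>]
    by simp_all
  then have "closed_segment z \<zeta> \<subseteq> cball 0 (1 - 2 * d)"
    by (intro closed_segment_subset) auto
  then have s_upper: "norm s \<le> 1 - 2 * d"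
    using s by auto
  have "norm (s - \<zeta>) \<le> 1 / 4"
    using segment_bound(2)[OF s] \<zeta>(2) by (simp add: norm_minus_commute)
  then have s_lower: "1 / 2 \<le> norm s"
    using \<zeta>(1) norm_triangle_sub[of \<zeta> s] by (simp add: norm_minus_commute)
  fix x assume "x \<in> ball s ((1 - r) / (2 * real P))"
  then have x: "norm (x - s) < d"
    by (simp add: d_def dist_norm norm_minus_commute)
  have "norm x < 1"
    using x s_upper d norm_triangle_sub[of x s] by simp
  moreover have "x \<noteq> 0"
    using x s_lower d by auto
  ultimately show "x \<in> ball 0 1 - {0}" by simp
qed

lemma ball_subset_punctured_disc_near_root:
  fixes z \<zeta> s :: complex
  assumes r: "0 < r" "r < 1" and "0 < m" "0 < M"
    and D: "- ln r \<le> D" "4 * D \<le> real M"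
    and \<zeta>: "norm \<zeta> ^ M = r" and z: "norm z ^ (m * M) \<le> r" "norm (z - \<zeta>) \<le> D / M"
    and s: "s \<in> closed_segment z \<zeta>"
  shows "ball s ((1 - r) / (2 * real (m * M))) \<subseteq> ball 0 1 - {0}"
proof (rule ball_subset_punctured_disc[OF r _ z(1) _ _ _ s])
  have gap: "D / M \<le> 1 / 4"
    using D(2) \<open>0 < M\<close> by (simp add: field_simps)
  then show "norm (z - \<zeta>) \<le> 1 / 4"
    using z(2) by linarith
  have "- (ln r / M) \<le> D / M"
    using D(1) \<open>0 < M\<close> by (simp add: field_simps)
  then show "3 / 4 \<le> norm \<zeta>"
    using one_plus_ln_div_le_of_power_eq[OF norm_ge_zero \<zeta> r(1) \<open>0 < M\<close>] gap by linarith
  show "norm \<zeta> ^ (m * M) \<le> r"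
    using \<zeta> r \<open>0 < m\<close> power_decreasing[of 1 m r] by (simp add: mult.commute[of m] power_mult)
qed (use \<open>0 < m\<close> \<open>0 < M\<close> in simp)

lemma univalent_distortion_near_root:
  fixes R :: "complex \<Rightarrow> complex"
  assumes hol: "R holomorphic_on ball 0 1 - {0}" and inj: "inj_on R (ball 0 1 - {0})"
    and r: "0 < r" "r < 1" and "0 < m" "0 < M"
    and D: "- ln r \<le> D" "4 * D \<le> real M"
    and \<zeta>: "norm \<zeta> ^ M = r" and z: "norm z ^ (m * M) \<le> r" "norm (z - \<zeta>) \<le> D / M"
  defines "A \<equiv> exp (koebe_const * (2 * m * D) / (1 - r))"
  shows "norm (R z - R \<zeta>) \<le> A * norm (deriv R \<zeta>) * (D / M)"
    and "norm (deriv R \<zeta>) \<le> A * norm (deriv R z)"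
proof -
  define d where "d = (1 - r) / (2 * real (m * M))"
  have "0 < d"
    using r \<open>0 < m\<close> \<open>0 < M\<close> by (simp add: d_def)
  have nbhd: "ball s d \<subseteq> ball 0 1 - {0}" if "s \<in> closed_segment z \<zeta>" for s
    unfolding d_def
    by (rule ball_subset_punctured_disc_near_root[OF r \<open>0 < m\<close> \<open>0 < M\<close> D \<zeta> z that])
  have "koebe_const / d * norm (z - \<zeta>) \<le> koebe_const / d * (D / M)"
    using z(2) koebe_const_pos \<open>0 < d\<close> by (intro mult_left_mono) auto
  also have "\<dots> = koebe_const * (2 * m * D) / (1 - r)"
    using \<open>0 < m\<close> \<open>0 < M\<close> r by (simp add: d_def field_simps)
  finally have exp_le: "exp (koebe_const / d * norm (z - \<zeta>)) \<le> A"
    by (simp add: A_def)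
  have "norm (R z - R \<zeta>)
      \<le> exp (koebe_const / d * norm (z - \<zeta>)) * norm (deriv R \<zeta>) * norm (z - \<zeta>)"
    by (rule univalent_norm_diff_le[OF hol inj \<open>0 < d\<close> nbhd])
  also have "\<dots> \<le> A * norm (deriv R \<zeta>) * (D / M)"
    using exp_le z(2) by (intro mult_mono) (auto simp: A_def)
  finally show "norm (R z - R \<zeta>) \<le> A * norm (deriv R \<zeta>) * (D / M)" .
  have "norm (deriv R \<zeta>) \<le> exp (koebe_const / d * norm (\<zeta> - z)) * norm (deriv R z)"
    using nbhd by (intro univalent_deriv_le[OF hol inj \<open>0 < d\<close>]) (metis closed_segment_commute)
  also have "\<dots> \<le> A * norm (deriv R z)"
    using exp_le by (intro mult_right_mono) (auto simp: norm_minus_commute)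
  finally show "norm (deriv R \<zeta>) \<le> A * norm (deriv R z)" .
qed

section \<open>Univalent functions with a pole\<close>

lemma univalent_pole_reciprocal:
  assumes hol: "R holomorphic_on U - {p}" and inj: "inj_on R (U - {p})"
    and pole: "is_pole R p" and U: "open U" "p \<in> U"
  obtains e Q where "0 < e" "ball p e \<subseteq> U"
    "Q holomorphic_on ball p e" "inj_on Q (ball p e)" "Q p = 0"
    "\<And>z. z \<in> ball p e - {p} \<Longrightarrow> R z = inverse (Q z) \<and> 1 \<le> norm (R z)"
proof -
  have "eventually (\<lambda>z. 1 \<le> norm (R z)) (at p)"
    using pole unfolding is_pole_def filterlim_at_infinity[OF order_refl]
    by (meson zero_less_one)
  then obtain e1 where e1: "0 < e1" "\<And>z. z \<noteq> p \<Longrightarrow> dist z p < e1 \<Longrightarrow> 1 \<le> norm (R z)"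
    unfolding eventually_at by blast
  obtain e2 where e2: "0 < e2" "ball p e2 \<subseteq> U"
    using U openE by blast
  define e where "e = min e1 e2"
  have e: "0 < e" "ball p e \<subseteq> U"
    using e1 e2 by (auto simp: e_def)
  have R_ge: "1 \<le> norm (R z)" if "z \<in> ball p e - {p}" for z
    using that e1(2)[of z] by (simp add: e_def dist_commute)
  then have R_nonzero: "R z \<noteq> 0" if "z \<in> ball p e - {p}" for z
    using that by fastforce
  define Q where "Q z = (if z = p then 0 else inverse (R z))" for z
  have "Q holomorphic_on ball p e"
    unfolding Q_def
    by (rule is_pole_inverse_holomorphic[OF open_ball holomorphic_on_subset[OF hol] pole])
      (use e(2) R_nonzero in auto)
  moreover have "inj_on Q (ball p e)"
  proof (rule inj_onI)
    fix x y assume xy: "x \<in> ball p e" "y \<in> ball p e" "Q x = Q y"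
    show "x = y"
    proof (cases "x = p \<or> y = p")
      case True
      then show ?thesis using xy R_nonzero by (auto simp: Q_def split: if_splits)
    next
      case False
      then have "R x = R y" using xy(3) by (simp add: Q_def)
      then show ?thesis using False xy e(2) by (intro inj_onD[OF inj, of x y]) auto
    qed
  qed
  ultimately show thesis
    using that[of e Q] e R_ge by (auto simp: Q_def)
qed

lemma univalent_pole_inverse_deriv_le:
  assumes hol: "R holomorphic_on U - {p}" and inj: "inj_on R (U - {p})"
    and pole: "is_pole R p" and U: "open U" "p \<in> U"
  obtains \<epsilon> C where "0 < \<epsilon>"
    "\<And>z. z \<in> ball p \<epsilon> - {p} \<Longrightarrow>
      1 \<le> norm (R z) \<and> inverse (norm (deriv R z)) \<le> C / norm (R z) ^ 2"
proof -
  obtain e Q where "0 < e"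
    and Q: "Q holomorphic_on ball p e" "inj_on Q (ball p e)"
    and R_eq: "\<And>z. z \<in> ball p e - {p} \<Longrightarrow> R z = inverse (Q z) \<and> 1 \<le> norm (R z)"
    using univalent_pole_reciprocal[OF hol inj pole U] by metis
  have sub: "cball p (e / 2) \<subseteq> ball p e"
    using \<open>0 < e\<close> by auto
  have "bounded ((\<lambda>z. inverse (deriv Q z)) ` cball p (e / 2))"
    by (rule univalent_inverse_deriv_bounded[OF Q(1) open_ball Q(2) compact_cball sub])
  then obtain C where C: "\<And>z. z \<in> cball p (e / 2) \<Longrightarrow> norm (inverse (deriv Q z)) \<le> C"
    unfolding bounded_iff by blast
  show thesis
  proof (rule that[of "e / 2" C])
    fix z assume z: "z \<in> ball p (e / 2) - {p}"
    then have z_in: "z \<in> ball p e - {p}"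
      using \<open>0 < e\<close> by auto
    then have "Q z \<noteq> 0"
      using R_eq by fastforce
    have "(Q has_field_derivative deriv Q z) (at z)"
      by (rule holomorphic_derivI[OF Q(1) open_ball]) (use z_in in auto)
    then have "((\<lambda>z. inverse (Q z)) has_field_derivative
        - (inverse (Q z) * deriv Q z * inverse (Q z))) (at z)"
      using \<open>Q z \<noteq> 0\<close> by (rule DERIV_inverse')
    then have "(R has_field_derivative - (inverse (Q z) * deriv Q z * inverse (Q z))) (at z)"
      by (rule has_field_derivative_transform_within_open[where S="ball p e - {p}"])
        (use z_in R_eq in auto)
    then have "deriv R z = - (R z * deriv Q z * R z)"
      using R_eq[OF z_in] by (simp add: DERIV_imp_deriv)
    then have "inverse (norm (deriv R z)) = norm (inverse (deriv Q z)) / norm (R z) ^ 2"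
      by (simp add: norm_mult norm_inverse divide_inverse power2_eq_square)
    also have "\<dots> \<le> C / norm (R z) ^ 2"
      using C[of z] z by (intro divide_right_mono) auto
    finally show "1 \<le> norm (R z) \<and> inverse (norm (deriv R z)) \<le> C / norm (R z) ^ 2"
      using R_eq[OF z_in] by blast
  qed (use \<open>0 < e\<close> in auto)
qed

lemma univalent_bounded_away_from_pole:
  assumes hol: "R holomorphic_on U - {p}" and inj: "inj_on R (U - {p})"
    and pole: "is_pole R p" and U: "open U" "p \<in> U" and "0 < \<epsilon>"
  shows "bounded (R ` (U - ball p \<epsilon>))"
proof -
  obtain e Q where e: "0 < e" "ball p e \<subseteq> U"
    and Q: "Q holomorphic_on ball p e" "inj_on Q (ball p e)" "Q p = 0"
    and R_eq: "\<And>z. z \<in> ball p e - {p} \<Longrightarrow> R z = inverse (Q z) \<and> 1 \<le> norm (R z)"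
    using univalent_pole_reciprocal[OF hol inj pole U] by metis
  define \<delta> where "\<delta> = min e \<epsilon>"
  have "open (Q ` ball p \<delta>)"
    by (rule open_mapping_thm3[OF holomorphic_on_subset[OF Q(1)] open_ball inj_on_subset[OF Q(2)]])
      (auto simp: \<delta>_def)
  moreover have "0 \<in> Q ` ball p \<delta>"
    using Q(3) e(1) \<open>0 < \<epsilon>\<close> by (force simp: \<delta>_def)
  ultimately obtain \<eta> where \<eta>: "0 < \<eta>" "ball 0 \<eta> \<subseteq> Q ` ball p \<delta>"
    by (meson openE)
  have "norm (R z) \<le> 1 / \<eta>" if z: "z \<in> U - ball p \<epsilon>" for z
  proof (rule ccontr)
    assume "\<not> norm (R z) \<le> 1 / \<eta>"
    then have big: "1 / \<eta> < norm (R z)" by simp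
    then have "0 < norm (R z)"
      using \<eta>(1) by (meson divide_pos_pos less_trans zero_less_one)
    then have "inverse (R z) \<in> ball 0 \<eta>"
      using big \<eta>(1) by (simp add: norm_divide field_simps)
    then obtain y where y: "y \<in> ball p \<delta>" "inverse (R z) = Q y"
      using \<eta>(2) by blast
    then have y_in: "y \<in> ball p e - {p}" "y \<in> ball p \<epsilon>"
      using \<open>0 < norm (R z)\<close> Q(3) by (auto simp: \<delta>_def)
    then have "R z = R y"
      using R_eq y(2) by (metis inverse_inverse_eq)
    then have "z = y"
      using z y_in e(2) \<open>0 < \<epsilon>\<close> by (intro inj_onD[OF inj, of z y]) auto
    then show False
      using y_in z by blast
  qed
  then show ?thesis
    by (intro boundedI[of _ "1 / \<eta>"]) blast
qed

section \<open>Integrals\<close>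

lemma powr_le_square_plus_power4:
  fixes x p :: real
  assumes "0 \<le> x" "2 \<le> p" "p \<le> 4"
  shows "x powr p \<le> x ^ 2 + x ^ 4"
proof (cases "x \<le> 1")
  case True
  then have "x powr p \<le> x powr 2"
    using assms by (intro powr_mono') auto
  then show ?thesis
    using \<open>0 \<le> x\<close> by (simp add: powr_numeral add_increasing2)
next
  case False
  then have "x powr p \<le> x powr 4"
    using assms by (intro powr_mono) auto
  then show ?thesis
    using \<open>0 \<le> x\<close> by (simp add: powr_numeral add_increasing)
qed

lemma square_plus_power4_le:
  fixes x c t :: real
  assumes "0 \<le> x" "x \<le> c / t ^ 2" "1 \<le> t"
  shows "x ^ 2 + x ^ 4 \<le> (c ^ 2 + c ^ 4) * (1 / t ^ 4)"
proof -
  have "x ^ 2 + x ^ 4 \<le> (c / t ^ 2) ^ 2 + (c / t ^ 2) ^ 4"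
    using assms by (intro add_mono power_mono)
  also have "\<dots> = c ^ 2 / t ^ 4 + c ^ 4 / t ^ 8"
    by (simp add: power_divide flip: power_mult)
  also have "\<dots> \<le> c ^ 2 / t ^ 4 + c ^ 4 / t ^ 4"
    using \<open>1 \<le> t\<close> by (intro add_left_mono divide_left_mono power_increasing) auto
  finally show ?thesis
    by (simp add: add_divide_distrib)
qed

lemma square_plus_power4_le_one_plus:
  fixes x :: real
  shows "x ^ 2 + x ^ 4 \<le> 1 + 2 * x ^ 4"
proof -
  have "2 * x ^ 2 \<le> 1 + x ^ 4"
    using zero_le_power2[of "x ^ 2 - 1"] by (simp add: power2_diff flip: power_mult)
  then show ?thesis
    using zero_le_power2[of x] by linarith
qed

lemma ennreal_le_suminf: "f k \<le> suminf f" for f :: "nat \<Rightarrow> ennreal"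
  using sum_le_suminf[OF summableI, of "{k}" f] by simp

lemma ennreal_affine_suminf_less:
  fixes s :: "nat \<Rightarrow> real"
  assumes "summable s" and "\<And>n. 0 \<le> s n" and "0 \<le> C" "0 \<le> K"
  shows "ennreal C * (\<Sum>n. ennreal (s n)) + ennreal K < ennreal (C * suminf s + (K + 1))"
proof -
  have "0 \<le> C * suminf s"
    using assms by (simp add: suminf_nonneg)
  then have "ennreal C * (\<Sum>n. ennreal (s n)) + ennreal K = ennreal (C * suminf s + K)"
    using assms by (simp add: suminf_ennreal2 suminf_nonneg ennreal_mult ennreal_plus)
  also have "\<dots> < ennreal (C * suminf s + (K + 1))"
    using \<open>0 \<le> C * suminf s\<close> \<open>0 \<le> K\<close> by (intro ennreal_lessI) auto
  finally show ?thesis .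
qed

lemma last_nat_before:
  assumes "P N" "N \<le> j" "\<not> P j"
  obtains n :: nat where "N \<le> n" "P n" "\<not> P (Suc n)"
  using assms by (metis dec_induct)

lemma exists_power_annulus:
  fixes x r :: real
  assumes "0 \<le> x" "x < 1" "0 < r" "2 \<le> m" "r \<le> x ^ m ^ N"
  obtains n where "N \<le> n" "r \<le> x ^ m ^ n" "x ^ m ^ Suc n < r"
proof -
  obtain j where j: "x ^ j < r"
    using real_arch_pow_inv[of r x] assms by auto
  have "j \<le> m ^ max N j"
    using power_gt_expt[of m "max N j"] assms(4) by linarith
  then have "x ^ m ^ max N j \<le> x ^ j"
    using assms by (intro power_decreasing) auto
  then have "\<not> r \<le> x ^ m ^ max N j"
    using j by linarith
  then show thesis
    using last_nat_before[of "\<lambda>n. r \<le> x ^ m ^ n" N "max N j"] assms(5) that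
    by (metis max.cobounded1 not_le)
qed

lemma borel_measurable_cmult_indicator_cball:
  "(\<lambda>x. c * indicator (cball a r) x :: ennreal) \<in> borel_measurable lborel"
  by (intro borel_measurable_times_ennreal borel_measurable_const borel_measurable_indicator) simp

lemma nn_integral_cmult_indicator_cball:
  fixes a :: "'a::euclidean_space"
  assumes "0 \<le> c" "0 \<le> r"
  shows "(\<integral>\<^sup>+ x. ennreal c * indicator (cball a r) x \<partial>lborel)
    = ennreal (c * (unit_ball_vol DIM('a) * r ^ DIM('a)))"
  using assms by (simp add: nn_integral_cmult_indicator emeasure_cball ennreal_mult)

lemma inverse_norm_power_le_dyadic_sum:
  fixes x :: "'a::real_normed_vector"
  assumes "1 \<le> norm x"
  shows "ennreal (1 / norm x ^ s)
    \<le> (\<Sum>k. ennreal (1 / (2 ^ k) ^ s) * indicator (cball 0 (2 ^ Suc k)) x)"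
proof -
  obtain j where "norm x < 2 ^ j"
    using real_arch_pow[of 2 "norm x"] by auto
  then obtain k where k: "2 ^ k \<le> norm x" "norm x < 2 ^ Suc k"
    using last_nat_before[of "\<lambda>k. 2 ^ k \<le> norm x" 0 j] assms by (auto simp: not_le)
  have "1 / norm x ^ s \<le> 1 / (2 ^ k) ^ s"
    using k(1) by (intro frac_le power_mono) auto
  then have "ennreal (1 / norm x ^ s)
      \<le> ennreal (1 / (2 ^ k) ^ s) * indicator (cball 0 (2 ^ Suc k)) x"
    using k(2) by (simp add: ennreal_leI)
  then show ?thesis
    using ennreal_le_suminf order_trans by fast
qed

lemma nn_integral_inverse_norm_power_finite:
  assumes "DIM('a::euclidean_space) < s"
  shows "(\<integral>\<^sup>+ x \<in> {x. 1 \<le> norm x}. ennreal (1 / norm (x::'a) ^ s) \<partial>lborel) < \<infinity>"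
proof -
  define D where "D = DIM('a)"
  define shell where "shell k x = ennreal (1 / (2 ^ k) ^ s) * indicator (cball 0 (2 ^ Suc k)) x"
    for k :: nat and x :: 'a
  define a :: "nat \<Rightarrow> real" where "a k = unit_ball_vol D * 2 ^ D * (2 ^ D / 2 ^ s) ^ k" for k
  have shell_integral: "(\<integral>\<^sup>+ x. shell k x \<partial>lborel) = ennreal (a k)" for k
  proof -
    have "1 / (2 ^ k) ^ s * (unit_ball_vol D * (2 ^ Suc k) ^ D) = a k"
      by (simp add: a_def power_divide power_mult_distrib mult.commute flip: power_mult)
    then show ?thesis
      unfolding shell_def D_def by (subst nn_integral_cmult_indicator_cball) auto
  qed
  have "(\<integral>\<^sup>+ x \<in> {x. 1 \<le> norm x}. ennreal (1 / norm (x::'a) ^ s) \<partial>lborel)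
      \<le> (\<integral>\<^sup>+ x. (\<Sum>k. shell k x) \<partial>lborel)"
    unfolding shell_def
    by (intro nn_integral_mono)
      (simp split: split_indicator del: power_Suc add: inverse_norm_power_le_dyadic_sum)
  also have "\<dots> = (\<Sum>k. \<integral>\<^sup>+ x. shell k x \<partial>lborel)"
    unfolding shell_def by (intro nn_integral_suminf borel_measurable_cmult_indicator_cball)
  also have "\<dots> = (\<Sum>k. ennreal (a k))"
    by (simp only: shell_integral)
  also have "\<dots> < \<infinity>"
  proof -
    have "(2::real) ^ D < 2 ^ s"
      using assms by (simp add: D_def)
    then have "summable a"
      unfolding a_def by (intro summable_mult summable_geometric) simp
    then have "(\<Sum>k. ennreal (a k)) \<noteq> top"
      by (rule ennreal_suminf_neq_top) (simp add: a_def)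
    then show ?thesis
      by (simp only: infinity_ennreal_def less_top)
  qed
  finally show ?thesis .
qed

section \<open>The basin of attraction\<close>

lemma poly_basin_inf:
  assumes "w \<in> basin_inf f"
  shows "poly f w \<in> basin_inf f"
proof -
  have "filterlim (\<lambda>n. (poly f ^^ Suc n) w) at_infinity sequentially"
    using assms by (subst filterlim_sequentially_Suc) (simp add: basin_inf_def)
  then show ?thesis by (simp add: basin_inf_def funpow_swap1)
qed

lemma poly_eq_if_inv_into_eq:
  assumes onto: "R ` U = basin_inf f" and "z \<in> U" and "inv_into U R (poly f (R z)) = y"
  shows "poly f (R z) = R y"
proof -
  have "poly f (R z) \<in> R ` U"
    using poly_basin_inf onto \<open>z \<in> U\<close> by blast
  then show ?thesis
    using f_inv_into_f assms(3) by metis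
qed

lemma funpow_poly_field_differentiable: "(poly f ^^ n) field_differentiable at (x::complex)"
proof (induction n arbitrary: x)
  case 0
  show ?case by (simp add: id_def)
next
  case (Suc n)
  have "poly f field_differentiable at ((poly f ^^ n) x)"
    using poly_DERIV field_differentiable_def by blast
  then show ?case using field_differentiable_compose[OF Suc] by (simp add: comp_def)
qed

locale boettcher_parametrization =
  fixes f :: "complex poly" and R :: "complex \<Rightarrow> complex" and z0 :: complex
  assumes degree_ge_2: "2 \<le> degree f"
    and hol: "R holomorphic_on ball 0 1 - {0}"
    and inj: "inj_on R (ball 0 1 - {0})"
    and pole: "is_pole R 0"
    and poly_R: "\<And>z. z \<in> ball 0 1 - {0} \<Longrightarrow> poly f (R z) = R (z ^ degree f)"
    and z0: "z0 \<in> ball 0 1 - {0}"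
begin

abbreviation punctured_disc :: "complex set" where
  "punctured_disc \<equiv> ball 0 1 - {0}"

abbreviation m :: nat where
  "m \<equiv> degree f"

definition roots :: "nat \<Rightarrow> complex set" where
  "roots n = {\<zeta>. \<zeta> \<in> ball 0 1 \<and> \<zeta> ^ (m ^ n) = z0}"

lemma open_punctured_disc: "open punctured_disc"
  by (simp add: open_delete)

lemma degree_pos: "0 < m"
  using degree_ge_2 by simp

lemma deriv_R_nonzero: "z \<in> punctured_disc \<Longrightarrow> deriv R z \<noteq> 0"
  by (rule holomorphic_injective_imp_regular[OF hol open_punctured_disc inj])

lemma power_in_punctured_disc: "z \<in> punctured_disc \<Longrightarrow> z ^ m ^ n \<in> punctured_disc"
  using degree_pos by (auto simp: norm_power power_less_one_iff)

lemma finite_roots: "finite (roots n)"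
  unfolding roots_def
  by (rule finite_subset[OF _ finite_nth_roots[of "m ^ n" z0]]) (use degree_pos in auto)

lemma roots_subset: "roots n \<subseteq> punctured_disc"
  using z0 degree_pos by (auto simp: roots_def power_0_left split: if_splits)

lemma norm_root_power: "\<zeta> \<in> roots n \<Longrightarrow> norm \<zeta> ^ m ^ n = norm z0"
  by (auto simp: roots_def simp flip: norm_power)

lemma S_sum_eq: "S_sum f R z0 n = (\<Sum>\<zeta>\<in>roots n. (norm (deriv (poly f ^^ n) (R \<zeta>)))\<^sup>2)"
  by (simp add: S_sum_def roots_def)

lemma funpow_poly_R:
  assumes "z \<in> punctured_disc"
  shows "(poly f ^^ n) (R z) = R (z ^ m ^ n)"
proof (induction n)
  case (Suc n)
  then show ?case
    using poly_R[OF power_in_punctured_disc[OF assms]]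
    by (simp add: mult.commute[of m] flip: power_mult)
qed simp

lemma deriv_funpow_poly_R:
  assumes z: "z \<in> punctured_disc"
  shows "deriv (poly f ^^ n) (R z) * deriv R z
    = deriv R (z ^ m ^ n) * (of_nat (m ^ n) * z ^ (m ^ n - 1))"
proof -
  have power_deriv:
    "((\<lambda>x. x ^ m ^ n) has_field_derivative of_nat (m ^ n) * z ^ (m ^ n - 1)) (at z)"
    by (auto intro!: derivative_eq_intros)
  have "((\<lambda>x. (poly f ^^ n) (R x)) has_field_derivative
      deriv (poly f ^^ n) (R z) * deriv R z) (at z)"
    by (rule DERIV_chain2[OF _ holomorphic_derivI[OF hol open_punctured_disc z]])
      (use funpow_poly_field_differentiable field_differentiable_derivI in blast)
  moreover have "((\<lambda>x. R (x ^ m ^ n)) has_field_derivative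
      deriv R (z ^ m ^ n) * (of_nat (m ^ n) * z ^ (m ^ n - 1))) (at z)"
    by (rule DERIV_chain2[OF holomorphic_derivI[OF hol open_punctured_disc
            power_in_punctured_disc[OF z]] power_deriv])
  then have "((\<lambda>x. (poly f ^^ n) (R x)) has_field_derivative
      deriv R (z ^ m ^ n) * (of_nat (m ^ n) * z ^ (m ^ n - 1))) (at z)"
    by (rule has_field_derivative_transform_within_open[OF _ open_punctured_disc z])
      (simp add: funpow_poly_R)
  ultimately show ?thesis
    by (rule DERIV_unique)
qed

lemma inverse_deriv_R_root_le:
  assumes "\<zeta> \<in> roots n"
  shows "inverse (norm (deriv R \<zeta>))
    \<le> norm (deriv (poly f ^^ n) (R \<zeta>)) / (norm (deriv R z0) * norm z0 * real m ^ n)"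
proof -
  have \<zeta>: "\<zeta> \<in> punctured_disc" "\<zeta> ^ m ^ n = z0"
    using assms roots_subset by (auto simp: roots_def)
  have "norm z0 = norm \<zeta> ^ m ^ n"
    using norm_root_power[OF assms] by simp
  also have "\<dots> \<le> norm \<zeta> ^ (m ^ n - 1)"
    using \<zeta>(1) by (intro power_decreasing) auto
  finally have "norm (deriv R z0) * norm z0 * real m ^ n
      \<le> norm (deriv R z0) * norm \<zeta> ^ (m ^ n - 1) * real m ^ n"
    by (intro mult_right_mono mult_left_mono) auto
  also have "\<dots> = norm (deriv (poly f ^^ n) (R \<zeta>) * deriv R \<zeta>)"
    using deriv_funpow_poly_R[OF \<zeta>(1), of n] \<zeta>(2) by (simp add: norm_mult norm_power)
  finally show ?thesis
    using deriv_R_nonzero[OF \<zeta>(1)] deriv_R_nonzero[OF z0] z0 degree_pos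
    by (simp add: norm_mult field_simps)
qed

definition root_dist :: real where
  "root_dist = pi - ln (norm z0)"

definition distortion :: real where
  "distortion = exp (koebe_const * (2 * m * root_dist) / (1 - norm z0))"

text \<open>Bounds \<open>|F'| ^ 4\<close> on the image under \<open>R\<close> of the part near \<open>\<zeta>\<close> of the annulus
  \<open>|z0| \<le> |z| ^ m ^ n\<close>, \<open>|z| ^ m ^ Suc n < |z0|\<close>.\<close>
definition root_tile :: "nat \<Rightarrow> complex \<Rightarrow> complex \<Rightarrow> ennreal" where
  "root_tile n \<zeta> w = ennreal ((distortion * inverse (norm (deriv R \<zeta>))) ^ 4) *
     indicator (cball (R \<zeta>) (distortion * norm (deriv R \<zeta>) * (root_dist / real m ^ n))) w"

definition root_tiles :: "nat \<Rightarrow> complex \<Rightarrow> ennreal" where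
  "root_tiles n w = (\<Sum>\<zeta>\<in>roots n. root_tile n \<zeta> w)"

definition tile_const :: real where
  "tile_const = pi * distortion ^ 6 * root_dist\<^sup>2 / (norm (deriv R z0) * norm z0)\<^sup>2"

lemma root_dist_ge: "- ln (norm z0) \<le> root_dist"
  by (simp add: root_dist_def)

lemma root_dist_nonneg: "0 \<le> root_dist"
proof -
  have "ln (norm z0) < 0"
    using z0 by simp
  then show ?thesis
    unfolding root_dist_def using pi_gt_zero by linarith
qed

lemma distortion_pos: "0 < distortion"
  by (simp add: distortion_def)

lemma tile_const_nonneg: "0 \<le> tile_const"
  by (simp add: tile_const_def distortion_def)

lemma root_tile_measurable: "root_tile n \<zeta> \<in> borel_measurable lborel"
  unfolding root_tile_def by (rule borel_measurable_cmult_indicator_cball)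

lemma root_tiles_measurable: "root_tiles n \<in> borel_measurable lborel"
  unfolding root_tiles_def by (intro borel_measurable_sum root_tile_measurable)

lemma exists_near_root:
  assumes "norm z0 \<le> norm z ^ m ^ n" "norm z \<le> 1"
  obtains \<zeta> where "\<zeta> \<in> roots n" "norm (z - \<zeta>) \<le> root_dist / real (m ^ n)"
proof -
  have "z0 \<noteq> 0" "0 < m ^ n"
    using z0 degree_pos by auto
  then obtain \<zeta> where \<zeta>: "\<zeta> ^ m ^ n = z0" and near: "norm (z - \<zeta>) \<le> root_dist / real (m ^ n)"
    using exists_root_near[OF _ _ assms] unfolding root_dist_def by blast
  have "norm \<zeta> ^ m ^ n < 1"
    using \<zeta> z0 by (simp flip: norm_power)
  then have "norm \<zeta> < 1"
    using one_le_power[of "norm \<zeta>" "m ^ n"] by linarith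
  then show thesis
    using that[of \<zeta>] \<zeta> near by (simp add: roots_def)
qed

lemma inverse_deriv_power4_le_root_tiles:
  assumes large: "4 * root_dist \<le> real m ^ n"
    and z: "norm z0 \<le> norm z ^ m ^ n" "norm z ^ m ^ Suc n < norm z0"
  shows "ennreal (inverse (norm (deriv R z)) ^ 4) \<le> root_tiles n (R z)"
proof -
  have M: "0 < m ^ n"
    using degree_pos by simp
  have r: "0 < norm z0" "norm z0 < 1"
    using z0 by auto
  have "norm z < 1"
    using z(2) r(2) one_le_power[of "norm z" "m ^ Suc n"] by linarith
  then have z_in: "z \<in> punctured_disc"
    using z(1) r(1) M by (auto simp: power_0_left)
  obtain \<zeta> where \<zeta>: "\<zeta> \<in> roots n" and near: "norm (z - \<zeta>) \<le> root_dist / real (m ^ n)"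
    using exists_near_root[OF z(1)] \<open>norm z < 1\<close> by auto
  have \<zeta>_in: "\<zeta> \<in> punctured_disc"
    using \<zeta> roots_subset by blast
  have R_near: "norm (R z - R \<zeta>) \<le> distortion * norm (deriv R \<zeta>) * (root_dist / real m ^ n)"
    and deriv_le: "norm (deriv R \<zeta>) \<le> distortion * norm (deriv R z)"
    using univalent_distortion_near_root[OF hol inj r degree_pos M root_dist_ge _
        norm_root_power[OF \<zeta>] _ near] large z(2)
    by (simp_all add: distortion_def)
  have "inverse (norm (deriv R z)) \<le> distortion * inverse (norm (deriv R \<zeta>))"
    using deriv_le deriv_R_nonzero[OF z_in] deriv_R_nonzero[OF \<zeta>_in] by (simp add: field_simps)
  then have "ennreal (inverse (norm (deriv R z)) ^ 4)
      \<le> ennreal ((distortion * inverse (norm (deriv R \<zeta>))) ^ 4)"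
    by (intro ennreal_leI power_mono) auto
  also have "\<dots> = root_tile n \<zeta> (R z)"
    using R_near by (simp add: root_tile_def dist_norm norm_minus_commute)
  also have "\<dots> \<le> root_tiles n (R z)"
    unfolding root_tiles_def using \<zeta> finite_roots by (intro member_le_sum) auto
  finally show ?thesis .
qed

lemma nn_integral_root_tile_le:
  assumes \<zeta>: "\<zeta> \<in> roots n"
  shows "(\<integral>\<^sup>+ w. root_tile n \<zeta> w \<partial>lborel)
    \<le> ennreal (tile_const * (1 / (real m ^ n) ^ 4 * (norm (deriv (poly f ^^ n) (R \<zeta>)))\<^sup>2))"
proof -
  define M where "M = real m ^ n"
  define q where "q = norm (deriv R \<zeta>)"
  define P where "P = norm (deriv (poly f ^^ n) (R \<zeta>))"
  have "0 < M"
    using degree_pos by (simp add: M_def)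
  have "\<zeta> \<in> punctured_disc"
    using roots_subset \<zeta> by blast
  then have "0 < q"
    using deriv_R_nonzero by (simp add: q_def)
  have "(\<integral>\<^sup>+ w. root_tile n \<zeta> w \<partial>lborel)
      = ennreal ((distortion * inverse q) ^ 4 * (pi * (distortion * q * (root_dist / M))\<^sup>2))"
    using \<open>0 < q\<close> \<open>0 < M\<close> distortion_pos root_dist_nonneg
    unfolding root_tile_def M_def[symmetric] q_def[symmetric]
    by (subst nn_integral_cmult_indicator_cball) (simp_all add: unit_ball_vol_2)
  also have "(distortion * inverse q) ^ 4 * (pi * (distortion * q * (root_dist / M))\<^sup>2)
      = pi * distortion ^ 6 * root_dist\<^sup>2 / M\<^sup>2 * (inverse q)\<^sup>2"
    using \<open>0 < q\<close> \<open>0 < M\<close> by (simp add: field_simps power2_eq_square eval_nat_numeral)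
  also have "ennreal \<dots> \<le> ennreal (pi * distortion ^ 6 * root_dist\<^sup>2 / M\<^sup>2
      * (P / (norm (deriv R z0) * norm z0 * M))\<^sup>2)"
    using inverse_deriv_R_root_le[OF \<zeta>] \<open>0 < q\<close> distortion_pos
    by (intro ennreal_leI mult_left_mono power_mono) (auto simp: q_def P_def M_def)
  also have "pi * distortion ^ 6 * root_dist\<^sup>2 / M\<^sup>2
        * (P / (norm (deriv R z0) * norm z0 * M))\<^sup>2
      = tile_const * (1 / M ^ 4 * P\<^sup>2)"
    by (simp add: tile_const_def power_divide power_mult_distrib power2_eq_square eval_nat_numeral)
  finally show ?thesis
    by (simp only: M_def P_def)
qed

lemma nn_integral_root_tiles_le:
  "(\<integral>\<^sup>+ w. root_tiles n w \<partial>lborel)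
    \<le> ennreal tile_const * ennreal (real m powr (- 4 * real n) * S_sum f R z0 n)"
proof -
  let ?P = "\<lambda>\<zeta>. norm (deriv (poly f ^^ n) (R \<zeta>))"
  have "real m powr (- 4 * real n) = inverse (real m powr (real (n * 4)))"
    by (simp add: powr_minus mult.commute)
  also have "\<dots> = 1 / (real m ^ n) ^ 4"
    using degree_pos by (subst powr_realpow) (auto simp: power_mult divide_inverse)
  finally have powr_eq: "real m powr (- 4 * real n) = 1 / (real m ^ n) ^ 4" .
  have "(\<integral>\<^sup>+ w. root_tiles n w \<partial>lborel)
      \<le> (\<Sum>\<zeta>\<in>roots n. ennreal (tile_const * (1 / (real m ^ n) ^ 4 * (?P \<zeta>)\<^sup>2)))"
    unfolding root_tiles_def
    by (subst nn_integral_sum[OF root_tile_measurable]) (intro sum_mono nn_integral_root_tile_le)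
  also have "\<dots> = ennreal (\<Sum>\<zeta>\<in>roots n. tile_const * (1 / (real m ^ n) ^ 4 * (?P \<zeta>)\<^sup>2))"
    using tile_const_nonneg by (intro sum_ennreal) simp
  also have "(\<Sum>\<zeta>\<in>roots n. tile_const * (1 / (real m ^ n) ^ 4 * (?P \<zeta>)\<^sup>2))
      = tile_const * (real m powr (- 4 * real n) * S_sum f R z0 n)"
    unfolding S_sum_eq powr_eq by (simp only: sum_distrib_left)
  finally show ?thesis
    using tile_const_nonneg by (simp add: ennreal_mult S_sum_def sum_nonneg)
qed

lemma nn_integral_suminf_root_tiles_le:
  "(\<integral>\<^sup>+ w. (\<Sum>n. root_tiles (Suc n) w) \<partial>lborel)
    \<le> ennreal tile_const
      * (\<Sum>n. ennreal (real m powr (- 4 * real (Suc n)) * S_sum f R z0 (Suc n)))"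
proof -
  have "(\<integral>\<^sup>+ w. (\<Sum>n. root_tiles (Suc n) w) \<partial>lborel)
      = (\<Sum>n. \<integral>\<^sup>+ w. root_tiles (Suc n) w \<partial>lborel)"
    by (rule nn_integral_suminf[OF root_tiles_measurable])
  also have "\<dots> \<le> (\<Sum>n. ennreal tile_const
      * ennreal (real m powr (- 4 * real (Suc n)) * S_sum f R z0 (Suc n)))"
    by (intro suminf_le nn_integral_root_tiles_le summableI)
  finally show ?thesis
    by (simp only: ennreal_suminf_cmult)
qed

lemma inverse_deriv_R_bounded_on_annulus:
  assumes "0 < \<epsilon>"
  obtains b where
    "\<And>z. \<epsilon> \<le> norm z \<Longrightarrow> norm z ^ P \<le> norm z0 \<Longrightarrow> inverse (norm (deriv R z)) \<le> b"
proof -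
  define T where "T = {z::complex. \<epsilon> \<le> norm z \<and> norm z ^ P \<le> norm z0}"
  have "T \<subseteq> punctured_disc"
  proof
    fix z assume z: "z \<in> T"
    then have "norm z ^ P < 1"
      using z0 by (simp add: T_def)
    then have "norm z < 1"
      using one_le_power[of "norm z" P] by linarith
    then show "z \<in> punctured_disc"
      using z \<open>0 < \<epsilon>\<close> by (auto simp: T_def)
  qed
  moreover have "closed T"
    unfolding T_def by (intro closed_Collect_conj closed_Collect_le continuous_intros)
  moreover have "bounded T"
    using \<open>T \<subseteq> punctured_disc\<close> by (meson bounded_ball bounded_diff bounded_subset)
  ultimately have "bounded ((\<lambda>z. inverse (deriv R z)) ` T)"
    by (intro univalent_inverse_deriv_bounded[OF hol open_punctured_disc inj])
      (simp_all add: compact_eq_bounded_closed)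
  then show thesis
    using that unfolding bounded_iff T_def by (auto simp: norm_inverse)
qed

lemma inverse_deriv_power4_le_away_from_pole:
  assumes "0 < \<epsilon>"
  obtains c where "0 \<le> c"
    "\<And>z. z \<in> ball 0 1 - ball 0 \<epsilon> \<Longrightarrow>
      ennreal (inverse (norm (deriv R z)) ^ 4) \<le> ennreal c + (\<Sum>n. root_tiles (Suc n) (R z))"
proof -
  obtain N0 where "4 * root_dist < real m ^ N0"
    using real_arch_pow[of "real m" "4 * root_dist"] degree_ge_2 by auto
  then have large: "4 * root_dist \<le> real m ^ n" if "Suc N0 \<le> n" for n
    using power_increasing[of N0 n "real m"] that degree_pos by simp
  obtain b where b: "\<And>z. \<epsilon> \<le> norm z \<Longrightarrow> norm z ^ m ^ Suc N0 \<le> norm z0 \<Longrightarrow>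
      inverse (norm (deriv R z)) \<le> b"
    using inverse_deriv_R_bounded_on_annulus[OF assms] by blast
  show thesis
  proof (rule that[of "b ^ 4"])
    fix z :: complex assume z: "z \<in> ball 0 1 - ball 0 \<epsilon>"
    show "ennreal (inverse (norm (deriv R z)) ^ 4)
        \<le> ennreal (b ^ 4) + (\<Sum>n. root_tiles (Suc n) (R z))"
    proof (cases "norm z ^ m ^ Suc N0 \<le> norm z0")
      case True
      then have "inverse (norm (deriv R z)) ^ 4 \<le> b ^ 4"
        using b[of z] z by (intro power_mono) auto
      then have "ennreal (inverse (norm (deriv R z)) ^ 4) \<le> ennreal (b ^ 4)"
        by (rule ennreal_leI)
      then show ?thesis
        by (rule order_trans) simp
    next
      case False
      then obtain n where n: "Suc N0 \<le> n"
          "norm z0 \<le> norm z ^ m ^ n" "norm z ^ m ^ Suc n < norm z0"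
        using exists_power_annulus[of "norm z" "norm z0" m "Suc N0"] z z0 degree_ge_2 by auto
      then obtain k where "n = Suc k"
        using Suc_le_D by blast
      then have "ennreal (inverse (norm (deriv R z)) ^ 4) \<le> root_tiles (Suc k) (R z)"
        using inverse_deriv_power4_le_root_tiles[OF large[OF n(1)] n(2,3)] by simp
      also have "\<dots> \<le> (\<Sum>n. root_tiles (Suc n) (R z))"
        by (rule ennreal_le_suminf)
      finally show ?thesis
        by (rule order_trans) simp
    qed
  qed simp
qed

lemma inverse_deriv_powers_le_away_from_pole:
  assumes "0 < \<epsilon>"
  obtains c where
    "\<And>z. z \<in> ball 0 1 - ball 0 \<epsilon> \<Longrightarrow>
      ennreal (inverse (norm (deriv R z)) ^ 2 + inverse (norm (deriv R z)) ^ 4)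
      \<le> ennreal c + 2 * (\<Sum>n. root_tiles (Suc n) (R z))"
proof -
  obtain c where "0 \<le> c" and power4_le: "\<And>z. z \<in> ball 0 1 - ball 0 \<epsilon> \<Longrightarrow>
      ennreal (inverse (norm (deriv R z)) ^ 4) \<le> ennreal c + (\<Sum>n. root_tiles (Suc n) (R z))"
    using inverse_deriv_power4_le_away_from_pole[OF \<open>0 < \<epsilon>\<close>] by blast
  have "ennreal (inverse (norm (deriv R z)) ^ 2 + inverse (norm (deriv R z)) ^ 4)
      \<le> ennreal (1 + 2 * c) + 2 * (\<Sum>n. root_tiles (Suc n) (R z))"
    if z: "z \<in> ball 0 1 - ball 0 \<epsilon>" for z
  proof -
    let ?x = "inverse (norm (deriv R z))" and ?tiles = "\<Sum>n. root_tiles (Suc n) (R z)"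
    have "ennreal (?x ^ 2 + ?x ^ 4) \<le> ennreal (1 + 2 * ?x ^ 4)"
      by (intro ennreal_leI square_plus_power4_le_one_plus)
    also have "\<dots> = 1 + 2 * ennreal (?x ^ 4)"
      by (simp add: ennreal_mult)
    also have "\<dots> \<le> 1 + 2 * (ennreal c + ?tiles)"
      by (intro add_left_mono mult_left_mono power4_le z) auto
    also have "\<dots> = ennreal (1 + 2 * c) + 2 * ?tiles"
      using \<open>0 \<le> c\<close> by (simp add: ennreal_mult distrib_left add.assoc)
    finally show ?thesis .
  qed
  then show thesis
    by (rule that)
qed

definition majorant :: "real \<Rightarrow> real \<Rightarrow> real \<Rightarrow> complex \<Rightarrow> ennreal" where
  "majorant c1 c2 B w = ennreal c1 * (ennreal (1 / norm w ^ 4) * indicator {w. 1 \<le> norm w} w)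
     + (ennreal c2 * indicator (cball 0 B) w + 2 * (\<Sum>n. root_tiles (Suc n) w))"

lemma tail_le_majorant:
  assumes "1 \<le> norm w" "0 \<le> c1"
  shows "ennreal (c1 * (1 / norm w ^ 4)) \<le> majorant c1 c2 B w"
proof -
  have "ennreal (c1 * (1 / norm w ^ 4)) = ennreal c1 * ennreal (1 / norm w ^ 4)"
    using \<open>0 \<le> c1\<close> by (intro ennreal_mult) auto
  then show ?thesis
    using \<open>1 \<le> norm w\<close> by (simp add: majorant_def add_increasing2)
qed

lemma tiles_le_majorant:
  assumes "norm w \<le> B"
  shows "ennreal c2 + 2 * (\<Sum>n. root_tiles (Suc n) w) \<le> majorant c1 c2 B w"
  using assms by (simp add: majorant_def add_increasing)

lemma inverse_deriv_powers_le_majorant: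
  obtains c1 c2 B where "0 < B"
    "\<And>z. z \<in> punctured_disc \<Longrightarrow>
      ennreal (inverse (norm (deriv R z)) ^ 2 + inverse (norm (deriv R z)) ^ 4)
      \<le> majorant c1 c2 B (R z)"
proof -
  obtain \<epsilon> C where "0 < \<epsilon>" and near_pole: "\<And>z. z \<in> ball 0 \<epsilon> - {0} \<Longrightarrow>
      1 \<le> norm (R z) \<and> inverse (norm (deriv R z)) \<le> C / norm (R z) ^ 2"
    using univalent_pole_inverse_deriv_le[OF hol inj pole open_ball]
    by (metis centre_in_ball zero_less_one)
  have "bounded (R ` (ball 0 1 - ball 0 \<epsilon>))"
    by (rule univalent_bounded_away_from_pole[OF hol inj pole _ _ \<open>0 < \<epsilon>\<close>]) auto
  then obtain B where B: "0 < B" "\<And>z. z \<in> ball 0 1 - ball 0 \<epsilon> \<Longrightarrow> norm (R z) \<le> B"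
    unfolding bounded_pos by blast
  obtain c where away: "\<And>z. z \<in> ball 0 1 - ball 0 \<epsilon> \<Longrightarrow>
      ennreal (inverse (norm (deriv R z)) ^ 2 + inverse (norm (deriv R z)) ^ 4)
      \<le> ennreal c + 2 * (\<Sum>n. root_tiles (Suc n) (R z))"
    using inverse_deriv_powers_le_away_from_pole[OF \<open>0 < \<epsilon>\<close>] by blast
  have "ennreal (inverse (norm (deriv R z)) ^ 2 + inverse (norm (deriv R z)) ^ 4)
      \<le> majorant (C ^ 2 + C ^ 4) c B (R z)" (is "?lhs \<le> _")
    if z: "z \<in> punctured_disc" for z
  proof (cases "z \<in> ball 0 \<epsilon>")
    case True
    then have R_ge: "1 \<le> norm (R z)" and le: "inverse (norm (deriv R z)) \<le> C / norm (R z) ^ 2"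
      using near_pole[of z] z by auto
    have "?lhs \<le> ennreal ((C ^ 2 + C ^ 4) * (1 / norm (R z) ^ 4))"
      by (intro ennreal_leI square_plus_power4_le R_ge le) simp
    also have "\<dots> \<le> majorant (C ^ 2 + C ^ 4) c B (R z)"
      by (rule tail_le_majorant[OF R_ge]) simp
    finally show ?thesis .
  next
    case False
    then have z_away: "z \<in> ball 0 1 - ball 0 \<epsilon>"
      using z by auto
    show ?thesis
      by (rule order_trans[OF away[OF z_away] tiles_le_majorant[OF B(2)[OF z_away]]])
  qed
  then show thesis
    using that B(1) by blast
qed

lemma nn_integral_majorant_le:
  assumes "0 \<le> B"
  obtains C K where "0 \<le> C" "0 \<le> K"
    "(\<integral>\<^sup>+ w. majorant c1 c2 B w \<partial>lborel)
      \<le> ennreal C * (\<Sum>n. ennreal (real m powr (- 4 * real (Suc n)) * S_sum f R z0 (Suc n)))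
        + ennreal K"
proof -
  define tail where "tail w = ennreal (1 / norm w ^ 4) * indicator {w. 1 \<le> norm w} w"
    for w :: complex
  define disc where "disc w = ennreal c2 * indicator (cball 0 B) w" for w :: complex
  define tiles where "tiles w = (\<Sum>n. root_tiles (Suc n) w)" for w
  define T where "T = (\<Sum>n. ennreal (real m powr (- 4 * real (Suc n)) * S_sum f R z0 (Suc n)))"
  have tail_measurable: "tail \<in> borel_measurable lborel"
    unfolding tail_def by measurable
  have disc_measurable: "disc \<in> borel_measurable lborel"
    unfolding disc_def by (rule borel_measurable_cmult_indicator_cball)
  have tiles_measurable: "tiles \<in> borel_measurable lborel"
    unfolding tiles_def by (intro borel_measurable_suminf_order root_tiles_measurable)
  define K where "K = ennreal c1 * (\<integral>\<^sup>+ w. tail w \<partial>lborel) + (\<integral>\<^sup>+ w. disc w \<partial>lborel)"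
  have "K < top"
    using nn_integral_inverse_norm_power_finite[where 'a = complex, of 4] \<open>0 \<le> B\<close>
    unfolding K_def tail_def disc_def
    by (simp add: nn_integral_cmult_indicator emeasure_cball ennreal_mult_less_top)
  have "(\<integral>\<^sup>+ w. majorant c1 c2 B w \<partial>lborel) = K + 2 * (\<integral>\<^sup>+ w. tiles w \<partial>lborel)"
    unfolding majorant_def tail_def[symmetric] disc_def[symmetric] tiles_def[symmetric] K_def
    using tail_measurable disc_measurable tiles_measurable
    by (simp add: nn_integral_add nn_integral_cmult add.assoc)
  also have "\<dots> \<le> K + 2 * (ennreal tile_const * T)"
    unfolding tiles_def T_def
    by (intro add_left_mono mult_left_mono nn_integral_suminf_root_tiles_le) auto
  also have "\<dots> = ennreal (2 * tile_const) * T + ennreal (enn2real K)"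
    using \<open>K < top\<close> tile_const_nonneg by (simp add: ennreal_mult ac_simps)
  finally show thesis
    using that[of "2 * tile_const" "enn2real K"] tile_const_nonneg unfolding T_def by simp
qed

lemma nn_integral_deriv_inv_into_powr_le:
  defines "F \<equiv> inv_into punctured_disc R"
  obtains C K where "0 \<le> C" "0 \<le> K"
    "\<And>p. 2 \<le> p \<Longrightarrow> p \<le> 4 \<Longrightarrow>
      (\<integral>\<^sup>+ w \<in> R ` punctured_disc. ennreal (norm (deriv F w) powr p) \<partial>lborel)
      \<le> ennreal C * (\<Sum>n. ennreal (real m powr (- 4 * real (Suc n)) * S_sum f R z0 (Suc n)))
        + ennreal K"
proof -
  obtain c1 c2 B where "0 < B" and le_majorant: "\<And>z. z \<in> punctured_disc \<Longrightarrow>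
      ennreal (inverse (norm (deriv R z)) ^ 2 + inverse (norm (deriv R z)) ^ 4)
      \<le> majorant c1 c2 B (R z)"
    using inverse_deriv_powers_le_majorant by metis
  have "ennreal (norm (deriv F w) powr p) * indicator (R ` punctured_disc) w \<le> majorant c1 c2 B w"
    if "2 \<le> p" "p \<le> 4" for p w
  proof (cases "w \<in> R ` punctured_disc")
    case True
    then obtain z where z: "z \<in> punctured_disc" "w = R z" by blast
    then have "norm (deriv F w) = inverse (norm (deriv R z))"
      unfolding F_def by (simp only: deriv_inv_into[OF hol open_punctured_disc inj] norm_inverse)
    then have "norm (deriv F w) powr p
        \<le> inverse (norm (deriv R z)) ^ 2 + inverse (norm (deriv R z)) ^ 4"
      using powr_le_square_plus_power4[OF norm_ge_zero that, of "deriv F w"] by simp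
    then have "ennreal (norm (deriv F w) powr p) \<le> majorant c1 c2 B w"
      using le_majorant[OF z(1)] z(2) by (blast intro: order_trans ennreal_leI)
    then show ?thesis
      using True by simp
  qed simp
  then have le: "(\<integral>\<^sup>+ w \<in> R ` punctured_disc. ennreal (norm (deriv F w) powr p) \<partial>lborel)
      \<le> (\<integral>\<^sup>+ w. majorant c1 c2 B w \<partial>lborel)" if "2 \<le> p" "p \<le> 4" for p
    using that by (intro nn_integral_mono)
  show thesis
    by (rule nn_integral_majorant_le[OF less_imp_le[OF \<open>0 < B\<close>]])
      (rule that[OF _ _ order_trans[OF le]])
qed

end

theorem mainTheorem5:
  fixes f :: "complex poly" and m :: nat
    and R F :: "complex \<Rightarrow> complex" and r0 :: real and z0 :: complex
  assumes deg: "degree f = m" and m2: "m \<ge> 2"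
    and R_holo: "R holomorphic_on (ball 0 1 - {0})"
    and R_inj: "inj_on R (ball 0 1 - {0})"
    and R_onto: "R ` (ball 0 1 - {0}) = basin_inf f"
    and R_pole: "filterlim R at_infinity (at 0)"
    and F_def: "F = inv_into (ball 0 1 - {0}) R"
    and conj: "\<And>z. z \<in> ball 0 1 - {0} \<Longrightarrow> F (poly f (R z)) = z ^ m"
    and r0: "0 < r0" "r0 < 1" and z0: "cmod z0 = r0"
  shows "\<exists>C1 C2 :: real. \<forall>p::real. 2 \<le> p \<and> p \<le> 4 \<longrightarrow>
           (summable (\<lambda>n. real m powr (- 4 * real (Suc n)) * S_sum f R z0 (Suc n)) \<longrightarrow>
            (\<integral>\<^sup>+ z \<in> basin_inf f. ennreal (cmod (deriv F z) powr p) \<partial>lborel)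
              < ennreal (C1 * (\<Sum>n. real m powr (- 4 * real (Suc n)) * S_sum f R z0 (Suc n)) + C2))"
proof -
  interpret boettcher_parametrization f R z0
    using assms poly_eq_if_inv_into_eq[OF R_onto]
    by unfold_locales (auto simp: is_pole_def)
  let ?s = "\<lambda>n. real m powr (- 4 * real (Suc n)) * S_sum f R z0 (Suc n)"
  obtain C K where "0 \<le> C" "0 \<le> K" and bound: "\<And>p. 2 \<le> p \<Longrightarrow> p \<le> 4 \<Longrightarrow>
      (\<integral>\<^sup>+ w \<in> basin_inf f. ennreal (cmod (deriv F w) powr p) \<partial>lborel)
      \<le> ennreal C * (\<Sum>n. ennreal (?s n)) + ennreal K"
    using nn_integral_deriv_inv_into_powr_le unfolding F_def R_onto deg by blast
  have "0 \<le> ?s n" for n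
    by (simp add: S_sum_def sum_nonneg)
  then have "ennreal C * (\<Sum>n. ennreal (?s n)) + ennreal K < ennreal (C * suminf ?s + (K + 1))"
    if "summable ?s"
    using ennreal_affine_suminf_less[OF that _ \<open>0 \<le> C\<close> \<open>0 \<le> K\<close>] by blast
  then show ?thesis
    using bound le_less_trans by blast
qed

end
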